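(* Let $A\in\mathbb{C}^{n\times n}$ be Hermitian, and let $\lambda_{\max}$ denote the largest eigenvalue of $A$. Then, with respect to the spectral norm, the structured level-2 condition number (for the structure of Hermitian matrices) and the unstructured level-2 condition number of the matrix exponential at $A$ satisfy $$\mathrm{cond}_{\mathrm{struc}}^{[2]}(\exp,A)=\mathrm{cond}^{[2]}(\exp,A)=e^{\lambda_{\max}}.$$
   Context: Let $\mathbb{S}_{\mathcal{M}}=\{Y\in\mathbb{C}^{n\times n}: Y^*=Y\}$ be the set of Hermitian matrices, let $f=\exp$ be the matrix exponential, and let $\|\cdot\|$ be the spectral norm. Unstructured condition numbers: for $A\in\mathbb{C}^{n\times n}$, with $E,Z$ ranging over $\mathbb{C}^{n\times n}$, $$\mathrm{cond}^{[1]}(f,A)=\lim_{\epsilon\to 0}\ \sup_{\|E\|\leq\epsilon}\frac{\|f(A+E)-f(A)\|}{\epsilon},$$ $$\mathrm{cond}^{[2]}(f,A)=\lim_{\epsilon\to 0}\ \sup_{\|Z\|\leq\epsilon}\frac{\left|\mathrm{cond}^{[1]}(f,A+Z)-\mathrm{cond}^{[1]}(f,A)\right|}{\epsilon}.$$ Structured condition numbers: for $A\in\mathbb{S}_{\mathcal{M}}$, $$\mathrm{cond}_{\mathrm{struc}}^{[1]}(f,A)=\lim_{\epsilon\to 0}\ \sup_{\substack{\|Y-A\|\leq\epsilon\\ Y\in\mathbb{S}_{\mathcal{M}}}}\frac{\|f(Y)-f(A)\|}{\epsilon},$$ $$\mathrm{cond}_{\mathrm{struc}}^{[2]}(f,A)=\lim_{\epsilon\to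 0}\ \sup_{\substack{A+Z\in\mathbb{S}_{\mathcal{M}}\\ \|Z\|\leq\epsilon}}\frac{\left|\mathrm{cond}_{\mathrm{struc}}^{[1]}(f,A+Z)-\mathrm{cond}_{\mathrm{struc}}^{[1]}(f,A)\right|}{\epsilon}.$$ *)

theory Defs
  imports "HOL-Analysis.Analysis"
begin

primrec matpow :: "'a::semiring_1^'n^'n \<Rightarrow> nat \<Rightarrow> 'a^'n^'n" where
  "matpow A 0 = mat 1"
| "matpow A (Suc k) = A ** matpow A k"

(* The library functions exp and (^) are of no use here: multiplication on the
   vector type is componentwise, not the matrix product. *)
definition matrix_exp :: "complex^'n^'n \<Rightarrow> complex^'n^'n" where
  "matrix_exp A = (\<Sum>k. (1 / fact k) *\<^sub>R matpow A k)"

(* The library norm on matrices is the Frobenius norm; the spectral norm is the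
   operator norm induced by the Euclidean norm on complex^'n. *)
definition spectral_norm :: "complex^'n^'m \<Rightarrow> real" where
  "spectral_norm A = onorm ((*v) A)"

definition hermitian_matrices :: "(complex^'n^'n) set" where
  "hermitian_matrices = {Y. map_matrix cnj (transpose Y) = Y}"

definition is_eigenvalue :: "complex^'n^'n \<Rightarrow> complex \<Rightarrow> bool" where
  "is_eigenvalue A \<mu> \<longleftrightarrow> (\<exists>v. v \<noteq> 0 \<and> A *v v = \<mu> *s v)"

(* For Hermitian matrices, all of whose eigenvalues are real. *)
definition lambda_max :: "complex^'n^'n \<Rightarrow> real" where
  "lambda_max A = Max {x. is_eigenvalue A (complex_of_real x)}"

(* Suprema and limits are taken in the extended reals, so that a supremum over an
   unbounded set is \<infinity> rather than unspecified. The step eps is positive, so the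
   limits are one-sided. Lim is unspecified if there is no limit; convergence
   has to be asserted of the quotients. *)

definition cond1_quot ::
    "(complex^'n^'n \<Rightarrow> complex^'n^'n) \<Rightarrow> complex^'n^'n \<Rightarrow> real \<Rightarrow> ereal" where
  "cond1_quot f A \<epsilon> =
     (SUP E\<in>{E. spectral_norm E \<le> \<epsilon>}. ereal (spectral_norm (f (A + E) - f A) / \<epsilon>))"

definition cond1 :: "(complex^'n^'n \<Rightarrow> complex^'n^'n) \<Rightarrow> complex^'n^'n \<Rightarrow> ereal" where
  "cond1 f A = Lim (at_right 0) (cond1_quot f A)"

definition cond2_quot ::
    "(complex^'n^'n \<Rightarrow> complex^'n^'n) \<Rightarrow> complex^'n^'n \<Rightarrow> real \<Rightarrow> ereal" where
  "cond2_quot f A \<epsilon> =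
     (SUP Z\<in>{Z. spectral_norm Z \<le> \<epsilon>}. \<bar>cond1 f (A + Z) - cond1 f A\<bar> / ereal \<epsilon>)"

definition cond2 :: "(complex^'n^'n \<Rightarrow> complex^'n^'n) \<Rightarrow> complex^'n^'n \<Rightarrow> ereal" where
  "cond2 f A = Lim (at_right 0) (cond2_quot f A)"

(* In the structured versions S is the set of structured matrices, and A is meant
   to belong to S. *)

definition cond1_struc_quot ::
    "(complex^'n^'n) set \<Rightarrow> (complex^'n^'n \<Rightarrow> complex^'n^'n) \<Rightarrow> complex^'n^'n \<Rightarrow> real \<Rightarrow> ereal" where
  "cond1_struc_quot S f A \<epsilon> =
     (SUP Y\<in>{Y. spectral_norm (Y - A) \<le> \<epsilon> \<and> Y \<in> S}. ereal (spectral_norm (f Y - f A) / \<epsilon>))"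

definition cond1_struc ::
    "(complex^'n^'n) set \<Rightarrow> (complex^'n^'n \<Rightarrow> complex^'n^'n) \<Rightarrow> complex^'n^'n \<Rightarrow> ereal" where
  "cond1_struc S f A = Lim (at_right 0) (cond1_struc_quot S f A)"

definition cond2_struc_quot ::
    "(complex^'n^'n) set \<Rightarrow> (complex^'n^'n \<Rightarrow> complex^'n^'n) \<Rightarrow> complex^'n^'n \<Rightarrow> real \<Rightarrow> ereal" where
  "cond2_struc_quot S f A \<epsilon> =
     (SUP Z\<in>{Z. A + Z \<in> S \<and> spectral_norm Z \<le> \<epsilon>}.
        \<bar>cond1_struc S f (A + Z) - cond1_struc S f A\<bar> / ereal \<epsilon>)"

definition cond2_struc ::
    "(complex^'n^'n) set \<Rightarrow> (complex^'n^'n \<Rightarrow> complex^'n^'n) \<Rightarrow> complex^'n^'n \<Rightarrow> ereal" where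
  "cond2_struc S f A = Lim (at_right 0) (cond2_struc_quot S f A)"

end

theory Submission
  imports Defs
begin

text \<open>
  The level-1 condition number of \<open>exp\<close> at \<open>X\<close> is the norm \<open>K X\<close> of the derivative of \<open>exp\<close> at \<open>X\<close>. The
  derivative maps the identity \<open>I\<close> to \<open>exp X\<close>, so \<open>norm (exp X) \<le> K X\<close>; the power series gives
  \<open>K X \<le> exp (norm X)\<close>, and after a shift by a scalar \<open>K X \<le> exp (norm (X + c I) - c)\<close>. If \<open>A\<close> is Hermitian
  with largest eigenvalue \<open>l\<close> and \<open>c\<close> makes \<open>A + c I\<close> positive semidefinite, then
  \<open>norm (A + c I) - c = l\<close> and \<open>norm (exp A) = exp l\<close>. For \<open>norm Z \<le> e\<close> this yields
  \<open>exp l * (2 - exp e) \<le> K (A + Z) \<le> exp l * exp e\<close>, where the upper bound is attained at \<open>Z = e I\<close>, so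
  the level-2 difference quotient is exactly \<open>exp l * (exp e - 1) / e\<close>. The argument applies to
  perturbations from any real subspace that contains \<open>I\<close>.
\<close>

section \<open>The exponential in a Banach algebra\<close>

text \<open>The derivative of \<open>x \<mapsto> x ^ k\<close> in direction \<open>y\<close>, that is, \<open>\<Sum>i+j=k-1. x ^ i * y * x ^ j\<close>. In a
  normed algebra, all estimates compare with the scalar case at \<open>norm x\<close> and \<open>norm y\<close>.\<close>

primrec dpow :: "nat \<Rightarrow> 'a::ring_1 \<Rightarrow> 'a \<Rightarrow> 'a" where
  "dpow 0 x y = 0"
| "dpow (Suc k) x y = x * dpow k x y + y * x ^ k"

text \<open>All \<open>Suc k\<close> words \<open>x ^ i * y * x ^ j\<close> with
  \<open>i + j = k\<close> collapse to \<open>x ^ k * y\<close>. The index \<open>Suc k\<close>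
  avoids a truncated exponent \<open>k - 1\<close>.\<close>

lemma dpow_Suc_commuting:
  assumes "x * y = y * x"
  shows "dpow (Suc k) x y = of_nat (Suc k) * (x ^ k * y)"
proof (induction k)
  case (Suc k)
  have "y * x ^ Suc k = x ^ Suc k * y"
    using assms power_commuting_commutes by metis
  moreover have "x * (of_nat (Suc k) * (x ^ k * y)) = of_nat (Suc k) * (x ^ Suc k * y)"
    by (simp only: mult.assoc[symmetric] power_Suc mult_of_nat_commute[of "Suc k" x])
  moreover have "dpow (Suc (Suc k)) x y = x * (of_nat (Suc k) * (x ^ k * y)) + y * x ^ Suc k"
    unfolding dpow.simps(2)[of "Suc k"] Suc.IH ..
  ultimately have "dpow (Suc (Suc k)) x y = of_nat (Suc k) * (x ^ Suc k * y) + 1 * (x ^ Suc k * y)"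
    by (metis mult_1_left)
  then show ?case
    by (metis add.commute distrib_right of_nat_Suc)
qed (use assms in simp)

lemma dpow_scaleR: "dpow k x (r *\<^sub>R y) = r *\<^sub>R dpow k x (y :: 'a::real_algebra_1)"
  by (induction k) (simp_all add: scaleR_add_right)

lemma norm_dpow_le:
  fixes x y :: "'a::real_normed_algebra_1"
  shows "norm (dpow k x y) \<le> dpow k (norm x) (norm y)"
proof (induction k)
  case (Suc k)
  have "norm (dpow (Suc k) x y) \<le> norm x * norm (dpow k x y) + norm y * norm (x ^ k)"
    by (auto intro!: order_trans[OF norm_triangle_ineq] add_mono norm_mult_ineq)
  also have "\<dots> \<le> norm x * dpow k (norm x) (norm y) + norm y * norm x ^ k"
    by (intro add_mono mult_left_mono Suc norm_power_ineq) auto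
  finally show ?case by simp
qed simp

text \<open>Expand \<open>(x + y) ^ k\<close> into noncommutative words: the difference consists of
  the words with at least one \<open>y\<close>, and each is bounded by its scalar
  counterpart.\<close>

lemma norm_power_add_diff_le:
  fixes x y :: "'a::real_normed_algebra_1"
  shows "norm ((x + y) ^ k - x ^ k) \<le> (norm x + norm y) ^ k - norm x ^ k"
proof (induction k)
  case (Suc k)
  have eq: "(x + y) ^ Suc k - x ^ Suc k = (x + y) * ((x + y) ^ k - x ^ k) + y * x ^ k"
    by (simp add: algebra_simps)
  have "norm ((x + y) ^ Suc k - x ^ Suc k)
      \<le> norm (x + y) * norm ((x + y) ^ k - x ^ k) + norm y * norm (x ^ k)"
    unfolding eq by (auto intro!: order_trans[OF norm_triangle_ineq] add_mono norm_mult_ineq)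
  also have "\<dots> \<le> (norm x + norm y) * ((norm x + norm y) ^ k - norm x ^ k) + norm y * norm x ^ k"
    by (intro add_mono mult_mono Suc norm_power_ineq norm_triangle_ineq) auto
  finally show ?case by (simp add: algebra_simps)
qed simp

text \<open>Subtracting also the words with exactly one \<open>y\<close> leaves those with at least
  two, and these are again bounded word by word.\<close>

lemma norm_power_add_diff_dpow_le:
  fixes x y :: "'a::real_normed_algebra_1"
  shows "norm ((x + y) ^ k - x ^ k - dpow k x y)
    \<le> (norm x + norm y) ^ k - norm x ^ k - dpow k (norm x) (norm y)"
proof (induction k)
  case (Suc k)
  \<comment> \<open>Split by the first letter: after \<open>x\<close> at least two letters
    \<open>y\<close> remain, after \<open>y\<close> at least one.\<close>
  have eq: "(x + y) ^ Suc k - x ^ Suc k - dpow (Suc k) x y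
      = x * ((x + y) ^ k - x ^ k - dpow k x y) + y * ((x + y) ^ k - x ^ k)"
    by (simp add: algebra_simps)
  have "norm ((x + y) ^ Suc k - x ^ Suc k - dpow (Suc k) x y)
      \<le> norm x * norm ((x + y) ^ k - x ^ k - dpow k x y) + norm y * norm ((x + y) ^ k - x ^ k)"
    unfolding eq by (auto intro!: order_trans[OF norm_triangle_ineq] add_mono norm_mult_ineq)
  also have "\<dots> \<le> norm x * ((norm x + norm y) ^ k - norm x ^ k - dpow k (norm x) (norm y))
      + norm y * ((norm x + norm y) ^ k - norm x ^ k)"
    by (intro add_mono mult_left_mono Suc norm_power_add_diff_le) auto
  finally show ?case by (simp add: algebra_simps)
qed simp

section \<open>The exponential series and its derivative\<close>

lemma exp_sums: "(\<lambda>k. x ^ k /\<^sub>R fact k) sums exp (x :: 'a::{real_normed_algebra_1,banach})"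
  by (simp add: exp_def summable_exp_generic summable_sums)

lemma dpow_commuting_sums:
  fixes x y :: "'a::{real_normed_algebra_1,banach}"
  assumes "x * y = y * x"
  shows "(\<lambda>k. dpow k x y /\<^sub>R fact k) sums (exp x * y)"
proof -
  have "dpow (Suc k) x y = real (Suc k) *\<^sub>R (x ^ k * y)" for k
    unfolding dpow_Suc_commuting[OF assms] scaleR_conv_of_real of_real_of_nat_eq ..
  then have "dpow (Suc k) x y /\<^sub>R fact (Suc k) = (x ^ k /\<^sub>R fact k) * y" for k
    by (simp add: field_simps del: of_nat_Suc dpow.simps)
  then have "(\<lambda>k. dpow (Suc k) x y /\<^sub>R fact (Suc k)) sums (exp x * y)"
    using sums_mult2[OF exp_sums, of x y] by simp
  \<comment> \<open>The term restored at index 0 is \<open>dpow 0 x y = 0\<close>.\<close>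
  then show ?thesis
    by (subst (asm) sums_Suc_iff) simp
qed

text \<open>The Frechet derivative of \<open>exp\<close> at \<open>x\<close> in direction
  \<open>y\<close>, by termwise differentiation of the power series;
  \<open>norm_exp_add_diff_frechet_le\<close> bounds the remainder.\<close>

definition exp_frechet :: "'a \<Rightarrow> 'a \<Rightarrow> 'a::{real_normed_algebra_1,banach}" where
  "exp_frechet x y = (\<Sum>k. dpow k x y /\<^sub>R fact k)"

lemma exp_frechet_commuting: "x * y = y * x \<Longrightarrow> exp_frechet x y = exp x * y"
  unfolding exp_frechet_def by (rule sums_unique[symmetric]) (rule dpow_commuting_sums)

text \<open>Real numbers commute, so the majorant series has a closed form; it is used at
  \<open>a = norm x\<close> and \<open>b = norm y\<close>.\<close>

lemma dpow_real_sums: "(\<lambda>k. dpow k a b / fact k) sums (exp a * b)" for a b :: real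
  using dpow_commuting_sums[of a b] by (simp add: mult.commute divide_inverse)

lemma exp_frechet_sums: "(\<lambda>k. dpow k x y /\<^sub>R fact k) sums exp_frechet x y"
  unfolding exp_frechet_def
proof (rule summable_sums, rule summable_comparison_test')
  show "summable (\<lambda>k. dpow k (norm x) (norm y) / fact k)"
    using dpow_real_sums sums_summable by blast
  show "norm (dpow k x y /\<^sub>R fact k) \<le> dpow k (norm x) (norm y) / fact k" if "k \<ge> 0" for k
    using norm_dpow_le[of k x y] by (simp add: field_simps)
qed

text \<open>Carries the termwise estimates for powers over to the exponential and its
  derivative.\<close>

lemma norm_sums_le:
  fixes f :: "nat \<Rightarrow> 'a::real_normed_vector"
  assumes "f sums s" "g sums t" "\<And>k. norm (f k) \<le> g k"
  shows "norm s \<le> t"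
proof (rule LIMSEQ_le)
  show "(\<lambda>n. norm (\<Sum>k<n. f k)) \<longlonglongrightarrow> norm s"
    using assms(1) unfolding sums_def by (rule tendsto_norm)
  show "(\<lambda>n. \<Sum>k<n. g k) \<longlonglongrightarrow> t" using assms(2) by (simp add: sums_def)
qed (use assms(3) in \<open>auto intro: sum_norm_le\<close>)

lemma norm_exp_frechet_le: "norm (exp_frechet x y) \<le> exp (norm x) * norm y"
  by (rule norm_sums_le[OF exp_frechet_sums dpow_real_sums])
    (use norm_dpow_le[of _ x y] in \<open>simp add: field_simps\<close>)

lemma exp_frechet_scaleR: "exp_frechet x (r *\<^sub>R y) = r *\<^sub>R exp_frechet x y"
proof -
  have "(\<lambda>k. dpow k x (r *\<^sub>R y) /\<^sub>R fact k) sums (r *\<^sub>R exp_frechet x y)"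
    using sums_scaleR_right[OF exp_frechet_sums, of r x y] by (simp add: dpow_scaleR mult.commute)
  then show ?thesis using exp_frechet_sums sums_unique2 by blast
qed

lemma real_exp_sums: "(\<lambda>k. a ^ k / fact k) sums exp a" for a :: real
  using exp_sums[of a] by (simp add: divide_inverse mult.commute)

lemma norm_exp_add_diff_le:
  fixes x y :: "'a::{real_normed_algebra_1,banach}"
  shows "norm (exp (x + y) - exp x) \<le> exp (norm x + norm y) - exp (norm x)"
proof (rule norm_sums_le)
  show "(\<lambda>k. (x + y) ^ k /\<^sub>R fact k - x ^ k /\<^sub>R fact k) sums (exp (x + y) - exp x)"
    by (intro sums_diff exp_sums)
  show "(\<lambda>k. (norm x + norm y) ^ k / fact k - norm x ^ k / fact k)
      sums (exp (norm x + norm y) - exp (norm x))"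
    by (intro sums_diff real_exp_sums)
  show "norm ((x + y) ^ k /\<^sub>R fact k - x ^ k /\<^sub>R fact k)
      \<le> (norm x + norm y) ^ k / fact k - norm x ^ k / fact k" for k
    using norm_power_add_diff_le[of x y k]
    by (simp add: divide_right_mono divide_inverse_commute[symmetric] flip: scaleR_diff_right diff_divide_distrib)
qed

lemma norm_exp_add_diff_frechet_le:
  fixes x y :: "'a::{real_normed_algebra_1,banach}"
  shows "norm (exp (x + y) - exp x - exp_frechet x y)
    \<le> exp (norm x + norm y) - exp (norm x) - exp (norm x) * norm y"
proof (rule norm_sums_le)
  show "(\<lambda>k. (x + y) ^ k /\<^sub>R fact k - x ^ k /\<^sub>R fact k - dpow k x y /\<^sub>R fact k)
      sums (exp (x + y) - exp x - exp_frechet x y)"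
    by (intro sums_diff exp_sums exp_frechet_sums)
  show "(\<lambda>k. (norm x + norm y) ^ k / fact k - norm x ^ k / fact k - dpow k (norm x) (norm y) / fact k)
      sums (exp (norm x + norm y) - exp (norm x) - exp (norm x) * norm y)"
    by (intro sums_diff real_exp_sums dpow_real_sums)
  show "norm ((x + y) ^ k /\<^sub>R fact k - x ^ k /\<^sub>R fact k - dpow k x y /\<^sub>R fact k)
      \<le> (norm x + norm y) ^ k / fact k - norm x ^ k / fact k - dpow k (norm x) (norm y) / fact k" for k
    using norm_power_add_diff_dpow_le[of x y k]
    by (simp add: divide_right_mono divide_inverse_commute[symmetric] flip: scaleR_diff_right diff_divide_distrib)
qed

lemma exp_add_of_real: "exp (x + of_real c) = exp c *\<^sub>R exp (x :: 'a::{real_normed_algebra_1,banach})"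
proof -
  have "x * of_real c = of_real c * x" by (simp add: of_real_def)
  then have "exp (x + of_real c) = exp x * of_real (exp c)"
    by (simp add: exp_add_commuting exp_of_real)
  then show ?thesis by (simp add: of_real_def)
qed

text \<open>Since \<open>norm (x + c) - c\<close> can be much smaller than \<open>norm x\<close>, shifting by a scalar \<open>c\<close> improves
  the bound. For Hermitian \<open>x\<close> and large \<open>c\<close> it equals the largest eigenvalue.\<close>

lemma norm_exp_add_diff_le_shift:
  fixes x y :: "'a::{real_normed_algebra_1,banach}"
  defines "b \<equiv> \<lambda>c. norm (x + of_real c) - c"
  shows "norm (exp (x + y) - exp x) \<le> exp (b c) * (exp (norm y) - 1)"
proof -
  \<comment> \<open>The factor \<open>exp c\<close> moves the base point from \<open>x\<close> to
    \<open>x + c\<close>, where the unshifted bound applies.\<close>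
  have "exp c * norm (exp (x + y) - exp x) = norm (exp (x + of_real c + y) - exp (x + of_real c))"
    using exp_add_of_real[of "x + y" c] exp_add_of_real[of x c]
    by (simp add: add_ac flip: scaleR_diff_right)
  also have "\<dots> \<le> exp (norm (x + of_real c) + norm y) - exp (norm (x + of_real c))"
    by (rule norm_exp_add_diff_le)
  also have "\<dots> = exp c * (exp (b c) * (exp (norm y) - 1))"
    by (simp add: b_def exp_add exp_diff field_simps)
  finally show ?thesis by simp
qed

text \<open>The limit and the difference quotient of the level-1 condition number of \<open>exp\<close> at \<open>x\<close>,
  with perturbations restricted to \<open>S\<close>.\<close>

definition exp_cond :: "'a set \<Rightarrow> 'a::{real_normed_algebra_1,banach} \<Rightarrow> real" where
  "exp_cond S x = (SUP y\<in>{y\<in>S. norm y \<le> 1}. norm (exp_frechet x y))"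

definition exp_quot :: "'a set \<Rightarrow> 'a::{real_normed_algebra_1,banach} \<Rightarrow> real \<Rightarrow> real" where
  "exp_quot S x e = (SUP y\<in>{y\<in>S. norm y \<le> e}. norm (exp (x + y) - exp x) / e)"

lemma exp_minus_one_over_tendsto: "((\<lambda>e::real. (exp e - 1) / e) \<longlongrightarrow> 1) (at_right 0)"
  using DERIV_exp[of "0::real"] unfolding DERIV_def
  by (auto intro: filterlim_mono at_le)

lemma exp_quot_bound:
  fixes x y :: "'a::{real_normed_algebra_1,banach}"
  assumes "e > 0" "norm y \<le> e"
  shows "norm (exp (x + y) - exp x) / e \<le> exp (norm (x + of_real c) - c) * ((exp e - 1) / e)"
proof -
  have "norm (exp (x + y) - exp x) \<le> exp (norm (x + of_real c) - c) * (exp (norm y) - 1)"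
    by (rule norm_exp_add_diff_le_shift)
  also have "\<dots> \<le> exp (norm (x + of_real c) - c) * (exp e - 1)"
    using assms by (intro mult_left_mono) auto
  finally show ?thesis using assms by (simp add: divide_right_mono)
qed

text \<open>A supremum of reals is meaningful only for bounded sets; the shift \<open>c = 0\<close>
  already gives a bound.\<close>

lemma bdd_above_exp_quot:
  assumes "e > 0"
  shows "bdd_above ((\<lambda>y. norm (exp (x + y) - exp x) / e) ` {y\<in>S. norm y \<le> e})"
  using exp_quot_bound[OF assms, of _ x 0] by (intro bdd_aboveI2) auto

lemma exp_quot_le:
  assumes "e > 0" "0 \<in> S"
  shows "exp_quot S x e \<le> exp (norm (x + of_real c) - c) * ((exp e - 1) / e)"
  unfolding exp_quot_def using assms by (intro cSUP_least exp_quot_bound) (auto intro: exI[of _ 0])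

lemma bdd_above_exp_cond: "bdd_above ((\<lambda>y. norm (exp_frechet x y)) ` {y\<in>S. norm y \<le> 1})"
proof (intro bdd_aboveI2)
  fix y assume "y \<in> {y\<in>S. norm y \<le> 1}"
  then show "norm (exp_frechet x y) \<le> exp (norm x)"
    using norm_exp_frechet_le[of x y] by (auto intro: order_trans mult_left_le)
qed

text \<open>On the ball of radius \<open>e\<close> the linearisation error divided by
  \<open>e\<close> is at most \<open>r e\<close>, uniformly in the direction. Scaling by
  \<open>e\<close> maps the unit ball of \<open>S\<close> onto that ball, so the two suprema differ
  by at most \<open>r e\<close>, which tends to 0.\<close>

lemma exp_quot_tendsto:
  fixes x :: "'a::{real_normed_algebra_1,banach}"
  assumes S: "subspace S"
  shows "(exp_quot S x \<longlongrightarrow> exp_cond S x) (at_right 0)"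
proof -
  \<comment> \<open>This is the scalar remainder \<open>exp (norm x) * (exp e - 1 - e)\<close>
    divided by \<open>e\<close>.\<close>
  define r where "r e = exp (norm x) * ((exp e - 1) / e - 1)" for e :: real
  have remainder: "norm (exp (x + y) - exp x - exp_frechet x y) / e \<le> r e"
    if "e > 0" "norm y \<le> e" for e y
  proof -
    \<comment> \<open>Monotonicity of \<open>exp t - 1 - t\<close> for \<open>t \<ge> 0\<close>:
      with \<open>d = e - t \<ge> 0\<close>,
      \<open>exp e = exp t * exp d \<ge> exp t * (1 + d) \<ge> exp t + d\<close>.\<close>
    have "exp (norm y) - 1 - norm y \<le> exp e - 1 - e"
    proof -
      have "1 \<le> exp (norm y)" "1 + (e - norm y) \<le> exp (e - norm y)" by (auto intro: exp_ge_add_one_self)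
      moreover have "exp (norm y) * 1 + 1 * (e - norm y) \<le> exp (norm y) * 1 + exp (norm y) * (e - norm y)"
        using that by (intro add_mono mult_right_mono) auto
      moreover have "exp (norm y) * (1 + (e - norm y)) \<le> exp (norm y) * exp (e - norm y)"
        by (intro mult_left_mono exp_ge_add_one_self) auto
      ultimately show ?thesis by (simp add: algebra_simps flip: exp_add)
    qed
    then have "exp (norm x) * (exp (norm y) - 1 - norm y) \<le> exp (norm x) * (exp e - 1 - e)"
      by (intro mult_left_mono) auto
    then have "norm (exp (x + y) - exp x - exp_frechet x y) \<le> exp (norm x) * (exp e - 1 - e)"
      using norm_exp_add_diff_frechet_le[of x y] by (simp add: exp_add algebra_simps)
    then show ?thesis using that by (simp add: r_def field_simps)
  qed
  have 0: "0 \<in> S" using S by (rule subspace_0)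
  have "\<bar>exp_quot S x e - exp_cond S x\<bar> \<le> r e" if e: "e > 0" for e
  proof -
    have "exp_quot S x e \<le> exp_cond S x + r e"
      unfolding exp_quot_def
    proof (rule cSUP_least)
      fix y assume y: "y \<in> {y\<in>S. norm y \<le> e}"
      have "(1 / e) *\<^sub>R y \<in> {y\<in>S. norm y \<le> 1}" using y e S by (auto simp: subspace_scale)
      from cSUP_upper[OF this bdd_above_exp_cond] have "norm (exp_frechet x y) / e \<le> exp_cond S x"
        using e by (simp add: exp_cond_def exp_frechet_scaleR)
      moreover have "norm (exp (x + y) - exp x)
          \<le> norm (exp (x + y) - exp x - exp_frechet x y) + norm (exp_frechet x y)"
        by (metis diff_add_cancel norm_triangle_ineq)
      then have "norm (exp (x + y) - exp x) / e
          \<le> norm (exp (x + y) - exp x - exp_frechet x y) / e + norm (exp_frechet x y) / e"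
        using e by (simp add: divide_right_mono flip: add_divide_distrib)
      ultimately show "norm (exp (x + y) - exp x) / e \<le> exp_cond S x + r e"
        using remainder[OF e, of y] y by simp
    qed (use 0 e in \<open>auto intro: exI[of _ 0]\<close>)
    moreover have "exp_cond S x \<le> exp_quot S x e + r e"
      unfolding exp_cond_def
    proof (rule cSUP_least)
      fix y assume y: "y \<in> {y\<in>S. norm y \<le> 1}"
      define z where "z = e *\<^sub>R y"
      have z: "z \<in> {y\<in>S. norm y \<le> e}" using y e S by (auto simp: z_def subspace_scale)
      from cSUP_upper[OF this bdd_above_exp_quot[OF e]]
      have "norm (exp (x + z) - exp x) / e \<le> exp_quot S x e" by (simp add: exp_quot_def)
      moreover have "norm (exp_frechet x z)
          \<le> norm (exp (x + z) - exp x - exp_frechet x z) + norm (exp (x + z) - exp x)"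
        by (metis add.commute norm_minus_commute norm_triangle_sub)
      then have "norm (exp_frechet x z) / e
          \<le> norm (exp (x + z) - exp x - exp_frechet x z) / e + norm (exp (x + z) - exp x) / e"
        using e by (simp add: divide_right_mono flip: add_divide_distrib)
      moreover have "norm (exp_frechet x z) / e = norm (exp_frechet x y)"
        using e by (simp add: z_def exp_frechet_scaleR)
      ultimately show "norm (exp_frechet x y) \<le> exp_quot S x e + r e"
        using remainder[OF e, of z] z by simp
    qed (use 0 in \<open>auto intro: exI[of _ 0]\<close>)
    ultimately show ?thesis by simp
  qed
  then have ev: "eventually (\<lambda>e. norm (exp_quot S x e - exp_cond S x) \<le> r e) (at_right 0)"
    by (auto intro: eventually_mono[OF eventually_at_right_less])
  have "(r \<longlongrightarrow> exp (norm x) * (1 - 1)) (at_right 0)"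
    unfolding r_def by (intro tendsto_intros exp_minus_one_over_tendsto)
  then have "((\<lambda>e. exp_quot S x e - exp_cond S x) \<longlongrightarrow> 0) (at_right 0)"
    using ev by (intro Lim_null_comparison[OF ev]) simp
  then show ?thesis by (simp add: LIM_zero_iff)
qed

section \<open>Sharp bounds for the level-1 condition number\<close>

text \<open>Let \<open>e\<close> tend to 0 in \<open>exp_quot_le\<close>; the shift by
  \<open>c\<close> is thereby inherited from the difference quotients.\<close>

lemma exp_cond_le:
  assumes "subspace S"
  shows "exp_cond S x \<le> exp (norm (x + of_real c) - c)"
proof (rule tendsto_le)
  show "((\<lambda>e. exp (norm (x + of_real c) - c) * ((exp e - 1) / e))
      \<longlongrightarrow> exp (norm (x + of_real c) - c)) (at_right 0)"
    using tendsto_mult_left[OF exp_minus_one_over_tendsto] by simp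
  show "eventually (\<lambda>e. exp_quot S x e \<le> exp (norm (x + of_real c) - c) * ((exp e - 1) / e)) (at_right 0)"
    using exp_quot_le subspace_0[OF assms] by (blast intro: eventually_mono[OF eventually_at_right_less])
qed (use exp_quot_tendsto[OF assms] in auto)

text \<open>The unit direction \<open>y = 1\<close> commutes with \<open>x\<close>, so the
  derivative there is \<open>exp x\<close>.\<close>

lemma norm_exp_le_exp_cond:
  assumes "1 \<in> S"
  shows "norm (exp x) \<le> exp_cond S x"
  using cSUP_upper[OF _ bdd_above_exp_cond, of 1 S x] assms
  by (simp add: exp_cond_def exp_frechet_commuting)

text \<open>The assumption on \<open>norm (exp x)\<close> says that the shift \<open>c\<close> makes
  the upper bound sharp at \<open>x\<close>. Upper side: \<open>z\<close> raises the shifted norm by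
  at most \<open>norm z\<close>. Lower side: \<open>norm (exp (x + z))\<close> bounds the condition
  number below and falls short of \<open>norm (exp x)\<close> by at most the increment of
  \<open>exp\<close>. Both deviations have the same bound.\<close>

lemma exp_cond_increment_le:
  fixes x z :: "'a::{real_normed_algebra_1,banach}"
  defines "l \<equiv> \<lambda>c. norm (x + of_real c) - c"
  assumes S: "subspace S" "1 \<in> S" and x: "norm (exp x) = exp (l c)"
  shows "\<bar>exp_cond S (x + z) - exp (l c)\<bar> \<le> exp (l c) * (exp (norm z) - 1)"
proof -
  have "norm (x + z + of_real c) - c \<le> l c + norm z"
    using norm_triangle_ineq[of "x + of_real c" z] by (simp add: l_def add_ac)
  then have "exp_cond S (x + z) \<le> exp (l c + norm z)"
    using exp_cond_le[OF S(1), of "x + z" c] by (meson exp_le_cancel_iff order_trans)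
  moreover have "norm (exp x) - norm (exp (x + z) - exp x) \<le> norm (exp (x + z))"
    using norm_triangle_ineq2[of "exp x" "exp x - exp (x + z)"] by (simp add: norm_minus_commute)
  then have "exp (l c) - exp (l c) * (exp (norm z) - 1) \<le> exp_cond S (x + z)"
    using norm_exp_add_diff_le_shift[of x z c] norm_exp_le_exp_cond[OF S(2), of "x + z"]
    by (simp add: l_def x[unfolded l_def])
  ultimately show ?thesis by (simp add: abs_le_iff exp_add algebra_simps)
qed

lemma exp_cond_eq:
  assumes "subspace S" "1 \<in> S" "norm (exp x) = exp (norm (x + of_real c) - c)"
  shows "exp_cond S x = norm (exp x)"
  using exp_cond_increment_le[OF assms, of 0] assms(3) by simp

text \<open>The increment bound is largest at \<open>norm z = e\<close> and is attained there, so
  the quotient is known exactly for every \<open>e > 0\<close>.\<close>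

lemma exp_cond_quot_eq:
  fixes x :: "'a::{real_normed_algebra_1,banach}"
  defines "l \<equiv> \<lambda>c. norm (x + of_real c) - c"
  assumes S: "subspace S" "1 \<in> S" and x: "norm (exp x) = exp (l c)" and e: "e > 0"
  shows "(SUP z\<in>{z\<in>S. norm z \<le> e}. ereal (\<bar>exp_cond S (x + z) - exp_cond S x\<bar> / e))
    = ereal (exp (l c) * ((exp e - 1) / e))"
proof (rule antisym)
  have K: "exp_cond S x = exp (l c)"
    using exp_cond_eq[OF S] x unfolding l_def by simp
  show "(SUP z\<in>{z\<in>S. norm z \<le> e}. ereal (\<bar>exp_cond S (x + z) - exp_cond S x\<bar> / e))
      \<le> ereal (exp (l c) * ((exp e - 1) / e))"
  proof (intro SUP_least)
    fix z assume z: "z \<in> {z\<in>S. norm z \<le> e}"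
    have "\<bar>exp_cond S (x + z) - exp (l c)\<bar> \<le> exp (l c) * (exp (norm z) - 1)"
      using exp_cond_increment_le[OF S] x unfolding l_def .
    also have "\<dots> \<le> exp (l c) * (exp e - 1)"
      using z by simp
    finally show "ereal (\<bar>exp_cond S (x + z) - exp_cond S x\<bar> / e) \<le> ereal (exp (l c) * ((exp e - 1) / e))"
      using e by (simp add: K divide_right_mono)
  qed
  \<comment> \<open>The extremal perturbation is \<open>e\<close> times the identity, which lies in
    \<open>S\<close> and multiplies \<open>exp x\<close> by \<open>exp e\<close>.\<close>
  have "norm (exp (x + of_real e)) = exp (l c) * exp e"
    using x by (simp add: exp_add_of_real)
  then have "exp (l c) * exp e \<le> exp_cond S (x + of_real e)"
    using norm_exp_le_exp_cond[OF S(2)] by metis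
  then have "ereal (exp (l c) * ((exp e - 1) / e)) \<le> ereal (\<bar>exp_cond S (x + of_real e) - exp_cond S x\<bar> / e)"
    using e by (simp add: K divide_right_mono right_diff_distrib)
  also have "\<dots> \<le> (SUP z\<in>{z\<in>S. norm z \<le> e}. ereal (\<bar>exp_cond S (x + z) - exp_cond S x\<bar> / e))"
    using S e by (intro SUP_upper) (auto simp: of_real_def subspace_scale)
  finally show "ereal (exp (l c) * ((exp e - 1) / e))
      \<le> (SUP z\<in>{z\<in>S. norm z \<le> e}. ereal (\<bar>exp_cond S (x + z) - exp_cond S x\<bar> / e))" .
qed

section \<open>The spectral norm\<close>

lemma spectral_norm_vec_le: "norm (A *v x) \<le> spectral_norm A * norm x" for A :: "complex^'n^'m"
  unfolding spectral_norm_def by (rule onorm) simp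

lemma spectral_norm_leI:
  fixes A :: "complex^'n^'m"
  assumes "\<And>x. norm (A *v x) \<le> b * norm x"
  shows "spectral_norm A \<le> b"
  unfolding spectral_norm_def by (rule onorm_le) (rule assms)

lemma spectral_norm_eq_0: "spectral_norm A = 0 \<longleftrightarrow> A = 0" for A :: "complex^'n^'m"
  unfolding spectral_norm_def by (subst onorm_eq_0) (auto simp: matrix_eq)

lemma spectral_norm_triangle: "spectral_norm (A + B) \<le> spectral_norm A + spectral_norm B"
  for A B :: "complex^'n^'m"
  using onorm_triangle[of "(*v) A" "(*v) B"]
  by (simp add: spectral_norm_def matrix_vector_mult_add_rdistrib[abs_def])

lemma scaleR_matrix_vector_mult: "(r *\<^sub>R A) *v x = r *\<^sub>R (A *v x)" for A :: "complex^'n^'m"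
  by (simp add: matrix_vector_mult_def vec_eq_iff scaleR_sum_right)

lemma spectral_norm_scaleR: "spectral_norm (r *\<^sub>R A) = \<bar>r\<bar> * spectral_norm A" for A :: "complex^'n^'m"
  using onorm_scaleR[of "(*v) A" r]
  by (simp add: spectral_norm_def scaleR_matrix_vector_mult[abs_def])

lemma spectral_norm_mult: "spectral_norm (A ** B) \<le> spectral_norm A * spectral_norm B"
  for A :: "complex^'n^'m" and B :: "complex^'k^'n"
  using onorm_compose[of "(*v) A" "(*v) B"]
  by (simp add: spectral_norm_def o_def matrix_vector_mul_assoc)

lemma spectral_norm_one: "spectral_norm (mat 1 :: complex^'n^'n) = 1"
  using onorm_id[where 'a = "complex^'n"] by (simp add: spectral_norm_def matrix_vector_mul_lid[abs_def])

lemma norm_vec_le_sum: "norm x \<le> (\<Sum>i\<in>UNIV. norm (x $ i))"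
  unfolding norm_vec_def by (rule L2_set_le_sum) simp

text \<open>Each entry is a coordinate of the image of a unit vector. The constant is crude; only
  the equivalence of the norms matters.\<close>

lemma norm_le_spectral_norm:
  "norm A \<le> real CARD('m) * real CARD('n) * spectral_norm A" for A :: "complex^'n^'m"
proof -
  have "norm (A $ i $ j) \<le> spectral_norm A" for i j
  proof -
    have "A $ i $ j = (A *v axis j 1) $ i"
      by (simp add: matrix_vector_mult_def axis_def if_distrib cong: if_cong)
    also have "norm \<dots> \<le> norm (A *v axis j 1)" by (rule Finite_Cartesian_Product.norm_nth_le)
    also have "\<dots> \<le> spectral_norm A" using spectral_norm_vec_le[of A "axis j 1"] by (simp add: norm_axis_1)
    finally show ?thesis .
  qed
  then have "(\<Sum>i\<in>UNIV. \<Sum>j\<in>UNIV. norm (A $ i $ j)) \<le> (\<Sum>i\<in>(UNIV::'m set). \<Sum>j\<in>(UNIV::'n set). spectral_norm A)"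
    by (intro sum_mono)
  moreover have "norm A \<le> (\<Sum>i\<in>UNIV. \<Sum>j\<in>UNIV. norm (A $ i $ j))"
    by (rule order_trans[OF norm_vec_le_sum]) (intro sum_mono norm_vec_le_sum)
  ultimately show ?thesis by simp
qed

lemma spectral_norm_le_norm:
  "spectral_norm A \<le> real CARD('m) * real CARD('n) * norm A" for A :: "complex^'n^'m"
proof (rule spectral_norm_leI)
  fix x
  have "norm ((A *v x) $ i) \<le> (\<Sum>j\<in>(UNIV::'n set). norm A * norm x)" for i
    unfolding matrix_vector_mult_def vec_lambda_beta
  proof (rule sum_norm_le)
    fix j
    have "norm (A $ i $ j) \<le> norm A"
      using Finite_Cartesian_Product.norm_nth_le[of "A $ i" j] Finite_Cartesian_Product.norm_nth_le[of A i]
      by (rule order_trans)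
    then show "norm (A $ i $ j * x $ j) \<le> norm A * norm x"
      unfolding norm_mult by (intro mult_mono Finite_Cartesian_Product.norm_nth_le) auto
  qed
  then have "(\<Sum>i\<in>UNIV. norm ((A *v x) $ i)) \<le> (\<Sum>i\<in>(UNIV::'m set). \<Sum>j\<in>(UNIV::'n set). norm A * norm x)"
    by (intro sum_mono)
  then show "norm (A *v x) \<le> real CARD('m) * real CARD('n) * norm A * norm x"
    using norm_vec_le_sum[of "A *v x"] by (simp add: mult.assoc)
qed

section \<open>The Banach algebra of matrices\<close>

text \<open>Square matrices with the matrix product and the spectral norm, so that the library function
  \<open>exp\<close> on this type is the matrix exponential.\<close>

typedef ('n::finite) opmat = "UNIV :: (complex^'n^'n) set"
  morphisms of_opmat opmat by simp

setup_lifting type_definition_opmat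

instantiation opmat :: (finite) real_normed_algebra_1
begin

lift_definition zero_opmat :: "'a opmat" is 0 .
lift_definition one_opmat :: "'a opmat" is "mat 1" .
lift_definition plus_opmat :: "'a opmat \<Rightarrow> 'a opmat \<Rightarrow> 'a opmat" is "(+)" .
lift_definition minus_opmat :: "'a opmat \<Rightarrow> 'a opmat \<Rightarrow> 'a opmat" is "(-)" .
lift_definition uminus_opmat :: "'a opmat \<Rightarrow> 'a opmat" is uminus .
lift_definition times_opmat :: "'a opmat \<Rightarrow> 'a opmat \<Rightarrow> 'a opmat" is "(**)" .
lift_definition scaleR_opmat :: "real \<Rightarrow> 'a opmat \<Rightarrow> 'a opmat" is scaleR .
lift_definition norm_opmat :: "'a opmat \<Rightarrow> real" is spectral_norm .

definition sgn_opmat :: "'a opmat \<Rightarrow> 'a opmat" where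
  "sgn_opmat x = scaleR (inverse (norm x)) x"
definition dist_opmat :: "'a opmat \<Rightarrow> 'a opmat \<Rightarrow> real" where
  "dist_opmat x y = norm (x - y)"
definition uniformity_opmat :: "('a opmat \<times> 'a opmat) filter" where
  "uniformity_opmat = (INF e\<in>{0 <..}. principal {(x, y). dist x y < e})"
definition open_opmat :: "'a opmat set \<Rightarrow> bool" where
  "open_opmat S = (\<forall>x\<in>S. \<forall>\<^sub>F (x', y) in uniformity. x' = x \<longrightarrow> y \<in> S)"

instance
proof
  fix x y z :: "'a opmat" and r s :: real
  show "x + y + z = x + (y + z)" "x + y = y + x" "0 + x = x" "- x + x = 0" "x - y = x + - y"
    by (transfer, simp)+
  show "r *\<^sub>R (x + y) = r *\<^sub>R x + r *\<^sub>R y" "(r + s) *\<^sub>R x = r *\<^sub>R x + s *\<^sub>R x"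
    "r *\<^sub>R s *\<^sub>R x = (r * s) *\<^sub>R x" "1 *\<^sub>R x = x"
    by (transfer, simp add: algebra_simps)+
  show "x * y * z = x * (y * z)" "1 * x = x" "x * 1 = x"
    by (transfer, simp add: matrix_mul_assoc)+
  show "(x + y) * z = x * z + y * z" "x * (y + z) = x * y + x * z"
    by (transfer, simp add: matrix_matrix_mult_def vec_eq_iff sum.distrib algebra_simps)+
  show "(r *\<^sub>R x) * y = r *\<^sub>R (x * y)" "x * (r *\<^sub>R y) = r *\<^sub>R (x * y)"
    by (transfer, simp add: matrix_matrix_mult_def vec_eq_iff scaleR_sum_right)+
  show "(0 :: 'a opmat) \<noteq> 1"
    by transfer (auto simp: mat_def vec_eq_iff)
  show "sgn x = inverse (norm x) *\<^sub>R x" "dist x y = norm (x - y)"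
    by (simp_all add: sgn_opmat_def dist_opmat_def)
  show "uniformity = (INF e\<in>{0 <..}. principal {(x :: 'a opmat, y). dist x y < e})"
    by (rule uniformity_opmat_def)
  show "open U \<longleftrightarrow> (\<forall>x\<in>U. \<forall>\<^sub>F (x', y) in uniformity. x' = x \<longrightarrow> y \<in> U)" for U :: "'a opmat set"
    by (rule open_opmat_def)
  show "norm x = 0 \<longleftrightarrow> x = 0" by transfer (rule spectral_norm_eq_0)
  show "norm (x + y) \<le> norm x + norm y" by transfer (rule spectral_norm_triangle)
  show "norm (r *\<^sub>R x) = \<bar>r\<bar> * norm x" by transfer (rule spectral_norm_scaleR)
  show "norm (x * y) \<le> norm x * norm y" by transfer (rule spectral_norm_mult)
  show "norm (1 :: 'a opmat) = 1" by transfer (rule spectral_norm_one)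
qed

end

text \<open>Completeness is inherited from \<open>complex^'n^'n\<close> with its library norm, since
  each norm is bounded by a multiple of the other.\<close>

instance opmat :: (finite) banach
proof
  fix X :: "nat \<Rightarrow> 'a opmat"
  assume X: "Cauchy X"
  let ?C = "real CARD('a) * real CARD('a)"
  have C: "?C > 0" by simp
  have "Cauchy (\<lambda>n. of_opmat (X n))"
  proof (rule metric_CauchyI)
    fix e :: real assume "e > 0"
    then obtain M where M: "\<And>m n. m \<ge> M \<Longrightarrow> n \<ge> M \<Longrightarrow> dist (X m) (X n) < e / ?C"
      using metric_CauchyD[OF X] C by (metis divide_pos_pos)
    have "dist (of_opmat (X m)) (of_opmat (X n)) < e" if "m \<ge> M" "n \<ge> M" for m n
    proof -
      have "dist (of_opmat (X m)) (of_opmat (X n)) \<le> ?C * dist (X m) (X n)"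
        unfolding dist_norm norm_opmat.rep_eq minus_opmat.rep_eq
        by (rule norm_le_spectral_norm)
      also have "\<dots> < ?C * (e / ?C)" using M[OF that] C by (intro mult_strict_left_mono)
      finally show ?thesis using C by simp
    qed
    then show "\<exists>M. \<forall>m\<ge>M. \<forall>n\<ge>M. dist (of_opmat (X m)) (of_opmat (X n)) < e" by blast
  qed
  then obtain L where L: "(\<lambda>n. of_opmat (X n)) \<longlonglongrightarrow> L"
    using Cauchy_convergent convergent_def by blast
  have "X \<longlonglongrightarrow> opmat L"
  proof (rule metric_LIMSEQ_I)
    fix e :: real assume "e > 0"
    then obtain M where M: "\<And>n. n \<ge> M \<Longrightarrow> dist (of_opmat (X n)) L < e / ?C"
      using metric_LIMSEQ_D[OF L] C by (metis divide_pos_pos)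
    have "dist (X n) (opmat L) < e" if "n \<ge> M" for n
    proof -
      have "dist (X n) (opmat L) \<le> ?C * dist (of_opmat (X n)) L"
        unfolding dist_norm norm_opmat.rep_eq minus_opmat.rep_eq
        using spectral_norm_le_norm by (simp add: opmat_inverse)
      also have "\<dots> < ?C * (e / ?C)" using M[OF that] C by (intro mult_strict_left_mono)
      finally show ?thesis using C by simp
    qed
    then show "\<exists>M. \<forall>n\<ge>M. dist (X n) (opmat L) < e" by blast
  qed
  then show "convergent X" by (auto simp: convergent_def)
qed

lemma of_opmat_opmat [simp]: "of_opmat (opmat A) = A"
  by (simp add: opmat_inverse)

lemma norm_opmat: "norm (opmat A) = spectral_norm A"
  by (simp add: norm_opmat.rep_eq)

lemma opmat_add: "opmat (A + B) = opmat A + opmat B"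
  by transfer simp

lemma bounded_linear_of_opmat: "bounded_linear (of_opmat :: 'n::finite opmat \<Rightarrow> _)"
proof (rule bounded_linear_intro)
  show "norm (of_opmat x) \<le> norm x * (real CARD('n) * real CARD('n))" for x :: "'n opmat"
    using norm_le_spectral_norm[of "of_opmat x"] by (simp add: norm_opmat.rep_eq mult.commute)
qed (simp_all add: plus_opmat.rep_eq scaleR_opmat.rep_eq)

lemma matpow_eq_power: "matpow A k = of_opmat (opmat A ^ k)"
  by (induction k) (simp_all add: one_opmat.rep_eq times_opmat.rep_eq)

text \<open>The series in \<open>matrix_exp\<close> converges in the library norm, that of
  \<open>exp\<close> in the spectral norm; the bounded linear map \<open>of_opmat\<close> carries
  one to the other.\<close>

lemma matrix_exp_eq_exp: "matrix_exp A = of_opmat (exp (opmat A))"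
proof -
  have "(\<lambda>k. of_opmat (opmat A ^ k /\<^sub>R fact k)) sums of_opmat (exp (opmat A))"
    by (intro bounded_linear.sums[OF bounded_linear_of_opmat] exp_sums)
  then show ?thesis
    unfolding matrix_exp_def matpow_eq_power
    by (auto simp: scaleR_opmat.rep_eq sums_iff divide_inverse)
qed

section \<open>Spectra of Hermitian matrices\<close>

text \<open>The form evaluated at \<open>x + t *\<^sub>R y\<close> is a nonnegative quadratic
  polynomial in \<open>t\<close>.\<close>

lemma psd_cauchy_schwarz:
  fixes f :: "'a::real_inner \<Rightarrow> 'a"
  assumes "linear f" and sym: "\<And>x y. f x \<bullet> y = x \<bullet> f y" and psd: "\<And>x. f x \<bullet> x \<ge> 0"
  shows "(f x \<bullet> y)\<^sup>2 \<le> (f x \<bullet> x) * (f y \<bullet> y)"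
proof -
  interpret linear f by fact
  have quadratic: "0 \<le> f x \<bullet> x + 2 * t * (f x \<bullet> y) + t\<^sup>2 * (f y \<bullet> y)" for t
  proof -
    have "f (x + t *\<^sub>R y) \<bullet> (x + t *\<^sub>R y) = f x \<bullet> x + 2 * t * (f x \<bullet> y) + t\<^sup>2 * (f y \<bullet> y)"
      using sym[of y x] by (simp add: add scale inner_simps power2_eq_square inner_commute algebra_simps)
    then show ?thesis using psd[of "x + t *\<^sub>R y"] by simp
  qed
  show ?thesis
  proof (cases "f y \<bullet> y = 0")
    case True
    have "f x \<bullet> y = 0"
    proof (rule ccontr)
      assume "f x \<bullet> y \<noteq> 0"
      \<comment> \<open>The polynomial is affine here; a nonzero slope lets it take the value
        -1.\<close>
      then have "f x \<bullet> x + 2 * (- (f x \<bullet> x + 1) / (2 * (f x \<bullet> y))) * (f x \<bullet> y) = -1"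
        by (simp add: field_simps)
      then show False using quadratic[of "- (f x \<bullet> x + 1) / (2 * (f x \<bullet> y))"] True by simp
    qed
    then show ?thesis using True by simp
  next
    case False
    then have pos: "f y \<bullet> y > 0" using psd[of y] by simp
    \<comment> \<open>Evaluate at the minimiser of the quadratic polynomial.\<close>
    have "f x \<bullet> x + 2 * (- (f x \<bullet> y) / (f y \<bullet> y)) * (f x \<bullet> y) + (- (f x \<bullet> y) / (f y \<bullet> y))\<^sup>2 * (f y \<bullet> y)
        = f x \<bullet> x - (f x \<bullet> y)\<^sup>2 / (f y \<bullet> y)"
      using pos by (simp add: field_simps power2_eq_square)
    then have "(f x \<bullet> y)\<^sup>2 / (f y \<bullet> y) \<le> f x \<bullet> x" using quadratic[of "- (f x \<bullet> y) / (f y \<bullet> y)"] by simp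
    then show ?thesis using pos by (simp add: pos_divide_le_eq)
  qed
qed

text \<open>Cauchy--Schwarz with \<open>y = f x\<close> bounds the fourth power of
  \<open>norm (f x)\<close> by a product of two Rayleigh quotient bounds; then cancel
  \<open>(norm (f x))\<^sup>2\<close>.\<close>

lemma psd_norm_le:
  fixes f :: "'a::real_inner \<Rightarrow> 'a"
  assumes f: "linear f" "\<And>x y. f x \<bullet> y = x \<bullet> f y" "\<And>x. f x \<bullet> x \<ge> 0"
    and m: "\<And>x. f x \<bullet> x \<le> m * (norm x)\<^sup>2"
  shows "norm (f x) \<le> m * norm x"
proof (cases "x = 0 \<or> f x = 0")
  case True
  then have "f x = 0" using linear_0[OF f(1)] by auto
  moreover from this have "0 \<le> m * (norm x)\<^sup>2" using m[of x] by simp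
  ultimately show ?thesis by (auto simp: zero_le_mult_iff)
next
  case False
  have "0 \<le> m * (norm x)\<^sup>2" using f(3)[of x] m[of x] by simp
  then have "m \<ge> 0" using False by (simp add: zero_le_mult_iff)
  have "(norm (f x))\<^sup>2 * (norm (f x))\<^sup>2 = (f x \<bullet> f x)\<^sup>2"
    unfolding power2_norm_eq_inner by (rule power2_eq_square[symmetric])
  also have "\<dots> \<le> (f x \<bullet> x) * (f (f x) \<bullet> f x)" by (rule psd_cauchy_schwarz[OF f])
  also have "\<dots> \<le> (m * (norm x)\<^sup>2) * (m * (norm (f x))\<^sup>2)"
    using m f(3) \<open>m \<ge> 0\<close> by (intro mult_mono) auto
  finally have "(norm (f x))\<^sup>2 * (norm (f x))\<^sup>2 \<le> (m * norm x)\<^sup>2 * (norm (f x))\<^sup>2"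
    by (simp add: power_mult_distrib power2_eq_square mult_ac)
  then have "(norm (f x))\<^sup>2 \<le> (m * norm x)\<^sup>2"
    by (rule mult_right_le_imp_le) (use False in simp)
  then show ?thesis
    by (rule power2_le_imp_le) (use \<open>m \<ge> 0\<close> in simp)
qed

text \<open>A vector maximising the Rayleigh quotient is an eigenvector: it annihilates the positive
  semidefinite form of \<open>m - f\<close>, so the Cauchy--Schwarz inequality for that form applies.\<close>

lemma self_adjoint_max_eigenvector:
  fixes f :: "'a::euclidean_space \<Rightarrow> 'a"
  assumes "linear f" and sym: "\<And>x y. f x \<bullet> y = x \<bullet> f y"
  obtains v m where "norm v = 1" "f v = m *\<^sub>R v" "\<And>x. f x \<bullet> x \<le> m * (norm x)\<^sup>2"
proof -
  interpret linear f by fact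
  have "continuous_on (sphere 0 1) (\<lambda>x. f x \<bullet> x)"
    using \<open>linear f\<close> by (intro continuous_intros linear_continuous_on) (simp add: linear_conv_bounded_linear)
  moreover have "sphere (0::'a) 1 \<noteq> {}" by simp
  ultimately obtain v where v: "norm v = 1" "\<And>y. norm y = 1 \<Longrightarrow> f y \<bullet> y \<le> f v \<bullet> v"
    using continuous_attains_sup[of "sphere (0::'a) 1" "\<lambda>x. f x \<bullet> x"] by auto
  define m where "m = f v \<bullet> v"
  have max: "f x \<bullet> x \<le> m * (norm x)\<^sup>2" for x
  proof (cases "x = 0")
    case True
    then show ?thesis by simp
  next
    case False
    have "(f x \<bullet> x) / (norm x)\<^sup>2 = f (x /\<^sub>R norm x) \<bullet> (x /\<^sub>R norm x)"
      by (simp add: scale power2_eq_square divide_inverse)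
    also have "\<dots> \<le> m" unfolding m_def using False by (intro v(2)) simp
    finally show ?thesis using False by (simp add: pos_divide_le_eq)
  qed
  define g where "g = (\<lambda>x. m *\<^sub>R x - f x)"
  have g: "linear g" "g x \<bullet> y = x \<bullet> g y" "g x \<bullet> x \<ge> 0" for x y
    unfolding g_def using sym[of x y] max[of x]
    by (auto intro!: linearI simp: add scale inner_simps algebra_simps power2_norm_eq_inner)
  have "(g v \<bullet> g v)\<^sup>2 \<le> (g v \<bullet> v) * (g (g v) \<bullet> g v)" by (rule psd_cauchy_schwarz[OF g])
  moreover have "g v \<bullet> v = 0"
    using v(1) by (simp add: g_def inner_diff_left m_def norm_eq_1)
  ultimately have "g v = 0" by simp
  then show ?thesis using that[OF v(1) _ max] by (simp add: g_def)
qed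

section \<open>Hermitian matrices and their largest eigenvalue\<close>

lemma subspace_hermitian_matrices: "subspace hermitian_matrices"
  by (auto simp: subspace_def hermitian_matrices_def vec_eq_iff transpose_def map_matrix_def)

lemma mat_1_hermitian: "mat 1 \<in> hermitian_matrices"
  by (auto simp: hermitian_matrices_def vec_eq_iff transpose_def map_matrix_def mat_def)

text \<open>The inner product on \<open>complex^'n\<close> is the real part of the Hermitian one, so
  \<open>A\<close> acts as a self-adjoint map of a real Euclidean space.\<close>

lemma hermitian_self_adjoint:
  assumes "A \<in> hermitian_matrices"
  shows "(A *v x) \<bullet> y = x \<bullet> (A *v y)"
proof -
  have A: "cnj (A $ j $ i) = A $ i $ j" for i j
    using assms by (auto simp: hermitian_matrices_def vec_eq_iff transpose_def map_matrix_def)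
  have "(A $ i $ j * x $ j) \<bullet> y $ i = x $ j \<bullet> (A $ j $ i * y $ i)" for i j
    unfolding A[of i j, symmetric] by (simp add: inner_complex_def algebra_simps)
  then show ?thesis
    unfolding inner_vec_def matrix_vector_mult_def
    by (simp add: inner_sum_left inner_sum_right) (rule sum.swap)
qed

lemma complex_of_real_smult: "complex_of_real r *s v = r *\<^sub>R v"
  by (simp add: vec_eq_iff) (simp add: scaleR_conv_of_real)

text \<open>Eigenvectors of distinct eigenvalues are orthogonal, hence independent. Finiteness makes
  the \<open>Max\<close> in \<open>lambda_max\<close> meaningful.\<close>

lemma hermitian_eigenvalues_finite:
  fixes A :: "complex^'n^'n"
  assumes A: "A \<in> hermitian_matrices"
  shows "finite {x. is_eigenvalue A (complex_of_real x)}" (is "finite ?E")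
proof -
  define e where "e x = (SOME v. v \<noteq> 0 \<and> A *v v = complex_of_real x *s v)" for x
  have e: "e x \<noteq> 0" "A *v e x = x *\<^sub>R e x" if "x \<in> ?E" for x
  proof -
    have "e x \<noteq> 0 \<and> A *v e x = complex_of_real x *s e x"
      unfolding e_def by (rule someI_ex) (use that in \<open>simp add: is_eigenvalue_def\<close>)
    then show "e x \<noteq> 0" "A *v e x = x *\<^sub>R e x"
      by (simp_all add: complex_of_real_smult)
  qed
  have orth: "e x \<bullet> e y = 0" if "x \<in> ?E" "y \<in> ?E" "x \<noteq> y" for x y
    using hermitian_self_adjoint[OF A, of "e x" "e y"] that by (simp add: e)
  have "inj_on e ?E"
  proof (rule inj_onI, rule ccontr)
    fix x y assume "x \<in> ?E" "y \<in> ?E" "e x = e y" "x \<noteq> y"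
    then show False using orth[of x y] e(1)[of x] by simp
  qed
  moreover have "pairwise orthogonal (e ` ?E)"
    using orth by (auto simp: pairwise_def orthogonal_def)
  then have "independent (e ` ?E)"
    by (rule pairwise_orthogonal_independent) (use e(1) in auto)
  then have "finite (e ` ?E)" by (rule finiteI_independent)
  ultimately show ?thesis using finite_imageD by blast
qed

text \<open>The vector \<open>v\<close> shows that \<open>m\<close> is an eigenvalue; the Rayleigh
  bound at any other eigenvector shows that it is the largest.\<close>

lemma lambda_max_eqI:
  fixes A :: "complex^'n^'n"
  assumes A: "A \<in> hermitian_matrices" and v: "norm v = 1" "A *v v = m *\<^sub>R v"
    and m: "\<And>x. (A *v x) \<bullet> x \<le> m * (norm x)\<^sup>2"
  shows "lambda_max A = m"
  unfolding lambda_max_def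
proof (rule Max_eqI[OF hermitian_eigenvalues_finite[OF A]])
  have "A *v v = complex_of_real m *s v" using v(2) by (simp add: complex_of_real_smult)
  moreover have "v \<noteq> 0" using v(1) by auto
  ultimately show "m \<in> {x. is_eigenvalue A (complex_of_real x)}"
    by (auto simp: is_eigenvalue_def)
next
  fix x assume "x \<in> {x. is_eigenvalue A (complex_of_real x)}"
  then obtain w where w: "w \<noteq> 0" "A *v w = x *\<^sub>R w"
    by (auto simp: is_eigenvalue_def complex_of_real_smult)
  then show "x \<le> m"
    using m[of w] by (simp add: power2_norm_eq_inner)
qed

text \<open>Evaluation at \<open>v\<close> is bounded linear, so it may be applied to the
  exponential series term by term.\<close>

lemma of_opmat_exp_eigenvector:
  assumes "of_opmat x *v v = m *\<^sub>R v"
  shows "of_opmat (exp x) *v v = exp m *\<^sub>R v"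
proof -
  have pow: "of_opmat (x ^ k) *v v = m ^ k *\<^sub>R v" for k
    by (induction k) (simp_all add: one_opmat.rep_eq times_opmat.rep_eq assms
        linear_scale[OF matrix_vector_mul_linear] flip: matrix_vector_mul_assoc)
  have "bounded_linear (\<lambda>y. of_opmat y *v v)"
    by (rule bounded_linear_intro[where K = "norm v"])
      (simp_all add: plus_opmat.rep_eq scaleR_opmat.rep_eq matrix_vector_mult_add_rdistrib
        scaleR_matrix_vector_mult norm_opmat.rep_eq spectral_norm_vec_le)
  from bounded_linear.sums[OF this exp_sums[of x]]
  have "(\<lambda>k. (m ^ k / fact k) *\<^sub>R v) sums (of_opmat (exp x) *v v)"
    by (simp add: scaleR_opmat.rep_eq scaleR_matrix_vector_mult pow divide_inverse mult.commute)
  moreover have "(\<lambda>k. (m ^ k / fact k) *\<^sub>R v) sums (exp m *\<^sub>R v)"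
    by (intro sums_scaleR_left real_exp_sums)
  ultimately show ?thesis using sums_unique2 by blast
qed

lemma of_opmat_of_real: "of_opmat (of_real c) *v v = c *\<^sub>R v"
  by (simp add: of_real_def scaleR_opmat.rep_eq one_opmat.rep_eq scaleR_matrix_vector_mult)

text \<open>With \<open>m\<close> the largest eigenvalue and \<open>N\<close> the norm of
  \<open>A + c I\<close>, the chain
  \<open>exp m \<le> norm (exp A) \<le> exp (N - c) \<le> exp m\<close> yields both equalities at
  once.\<close>

lemma hermitian_shift:
  fixes A :: "complex^'n^'n"
  assumes A: "A \<in> hermitian_matrices"
  obtains c where "norm (opmat A + of_real c) - c = lambda_max A"
    "norm (exp (opmat A)) = exp (lambda_max A)"
proof -
  define f where "f = (*v) A"
  have f: "linear f" "f x \<bullet> y = x \<bullet> f y" for x y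
    using hermitian_self_adjoint[OF A] by (auto simp: f_def)
  then obtain v m where v: "norm v = 1" "f v = m *\<^sub>R v" and max: "\<And>x. f x \<bullet> x \<le> m * (norm x)\<^sup>2"
    using self_adjoint_max_eigenvector[of f] by metis
  have m: "lambda_max A = m"
    using lambda_max_eqI[OF A v(1)] v(2) max unfolding f_def by blast
  \<comment> \<open>Large enough to make \<open>A + c I\<close> positive semidefinite, so that its
    Rayleigh bound \<open>m + c\<close> also bounds its norm.\<close>
  define c where "c = spectral_norm A"
  define g where "g x = f x + c *\<^sub>R x" for x
  have psd: "g x \<bullet> x \<ge> 0" for x
  proof -
    have "\<bar>f x \<bullet> x\<bar> \<le> norm (f x) * norm x" by (rule Cauchy_Schwarz_ineq2)
    also have "\<dots> \<le> (c * norm x) * norm x"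
      unfolding f_def c_def by (intro mult_right_mono spectral_norm_vec_le) auto
    finally show ?thesis
      by (simp add: g_def inner_add_left power2_eq_square flip: power2_norm_eq_inner)
  qed
  have g: "linear g" "g x \<bullet> y = x \<bullet> g y" "g x \<bullet> x \<le> (m + c) * (norm x)\<^sup>2" for x y
    using f(2)[of x y] max[of x] unfolding g_def
    by (auto intro!: linearI simp: linear_add[OF f(1)] linear_scale[OF f(1)] inner_add_left
        inner_add_right power2_norm_eq_inner algebra_simps)
  have "of_opmat (opmat A + of_real c) *v x = g x" for x
    by (simp add: plus_opmat.rep_eq matrix_vector_mult_add_rdistrib of_opmat_of_real f_def g_def)
  note G = this
  have le: "norm (opmat A + of_real c) \<le> m + c"
    unfolding norm_opmat.rep_eq
    by (rule spectral_norm_leI) (simp add: G psd_norm_le[OF g(1,2) psd g(3)])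
  have "exp m = norm (of_opmat (exp (opmat A)) *v v)"
    using of_opmat_exp_eigenvector[of "opmat A" v m] v by (simp add: f_def)
  also have "\<dots> \<le> norm (exp (opmat A))"
    using spectral_norm_vec_le[of "of_opmat (exp (opmat A))" v] v(1) by (simp add: norm_opmat.rep_eq)
  finally have ge: "exp m \<le> norm (exp (opmat A))" .
  have "norm (exp (opmat A)) * exp c = norm (exp (opmat A + of_real c))"
    by (simp add: exp_add_of_real)
  also have "\<dots> \<le> exp (norm (opmat A + of_real c))" by (rule norm_exp)
  finally have upper: "norm (exp (opmat A)) \<le> exp (norm (opmat A + of_real c) - c)"
    by (simp add: exp_diff pos_le_divide_eq)
  have "m \<le> norm (opmat A + of_real c) - c"
    using order_trans[OF ge upper] by simp
  with le have "norm (opmat A + of_real c) - c = m" by simp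
  moreover from this have "norm (exp (opmat A)) = exp m" using ge upper by simp
  ultimately show ?thesis using that m by metis
qed

section \<open>Condition numbers of the matrix exponential\<close>

text \<open>Substituting \<open>Y = A + E\<close> makes the unstructured case the structured one for
  \<open>UNIV\<close>, so a single argument covers both.\<close>

lemma cond1_quot_eq_struc: "cond1_quot f A = cond1_struc_quot UNIV f A"
proof
  fix e
  have "{E. spectral_norm E \<le> e} = (\<lambda>Y. Y - A) ` {Y. spectral_norm (Y - A) \<le> e \<and> Y \<in> UNIV}"
    by (auto intro: image_eqI[of _ _ "_ + A"])
  then show "cond1_quot f A e = cond1_struc_quot UNIV f A e"
    unfolding cond1_quot_def cond1_struc_quot_def by (simp only: image_image) simp
qed

lemma cond2_quot_eq_struc: "cond2_quot f A = cond2_struc_quot UNIV f A"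
  by (auto simp: cond2_quot_def cond2_struc_quot_def cond1_def cond1_struc_def cond1_quot_eq_struc)

text \<open>Links the extended-real suprema of the condition numbers to the real ones in
  \<open>exp_quot\<close>.\<close>

lemma ereal_SUP_bdd:
  assumes "A \<noteq> {}" "bdd_above (f ` A)"
  shows "(SUP a\<in>A. ereal (f a)) = ereal (SUP a\<in>A. f a)"
proof (rule ereal_SUP[symmetric])
  obtain M where M: "\<And>a. a \<in> A \<Longrightarrow> f a \<le> M" using assms(2) by (auto simp: bdd_above_def)
  obtain a where a: "a \<in> A" using assms(1) by blast
  have "(SUP a\<in>A. ereal (f a)) \<le> ereal M" by (intro SUP_least) (simp add: M)
  moreover have "ereal (f a) \<le> (SUP a\<in>A. ereal (f a))" using a by (intro SUP_upper)
  ultimately show "\<bar>SUP a\<in>A. ereal (f a)\<bar> \<noteq> \<infinity>" by auto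
qed

lemma subspace_of_opmat_vimage:
  assumes "subspace S"
  shows "subspace (of_opmat -` S)"
  using assms by (simp add: subspace_def zero_opmat.rep_eq plus_opmat.rep_eq scaleR_opmat.rep_eq)

lemma SUP_opmat:
  "(SUP Z\<in>{Z. P Z}. F Z) = (SUP z\<in>{z. P (of_opmat z)}. F (of_opmat z))"
proof -
  have "{Z. P Z} = of_opmat ` {z. P (of_opmat z)}"
    by (auto intro: image_eqI[of _ _ "opmat _"])
  then show ?thesis by (simp only: image_image)
qed

text \<open>As \<open>B\<close> lies in the subspace \<open>S\<close>, translation by
  \<open>B\<close> maps \<open>S\<close> onto itself, and the admissible \<open>Y\<close> are
  \<open>B + y\<close> with \<open>y\<close> in \<open>S\<close>.\<close>

lemma cond1_struc_quot_exp:
  fixes B :: "complex^'n^'n"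
  assumes S: "subspace S" and B: "B \<in> S" and e: "e > 0"
  shows "cond1_struc_quot S matrix_exp B e = ereal (exp_quot (of_opmat -` S) (opmat B) e)"
proof -
  let ?T = "{y \<in> of_opmat -` S. norm y \<le> e}"
  have "{Y. spectral_norm (Y - B) \<le> e \<and> Y \<in> S} = (\<lambda>y. B + of_opmat y) ` ?T"
  proof (intro equalityI subsetI)
    fix Y assume "Y \<in> {Y. spectral_norm (Y - B) \<le> e \<and> Y \<in> S}"
    then show "Y \<in> (\<lambda>y. B + of_opmat y) ` ?T"
      using S B by (intro image_eqI[of _ _ "opmat (Y - B)"]) (auto simp: norm_opmat subspace_diff)
  qed (use S B in \<open>auto simp: norm_opmat.rep_eq subspace_add\<close>)
  then have "cond1_struc_quot S matrix_exp B e
      = (SUP y\<in>?T. ereal (norm (exp (opmat B + y) - exp (opmat B)) / e))"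
    unfolding cond1_struc_quot_def
    by (simp add: image_image matrix_exp_eq_exp opmat_add of_opmat_inverse norm_opmat.rep_eq minus_opmat.rep_eq)
  also have "\<dots> = ereal (exp_quot (of_opmat -` S) (opmat B) e)"
    unfolding exp_quot_def
  proof (rule ereal_SUP_bdd[OF _ bdd_above_exp_quot[OF e]])
    show "?T \<noteq> {}" using subspace_0[OF S] e by (auto simp: zero_opmat.rep_eq intro: exI[of _ 0])
  qed
  finally show ?thesis .
qed

lemma cond1_struc_quot_exp_tendsto:
  fixes B :: "complex^'n^'n"
  assumes "subspace S" "B \<in> S"
  shows "(cond1_struc_quot S matrix_exp B \<longlongrightarrow> ereal (exp_cond (of_opmat -` S) (opmat B))) (at_right 0)"
proof (rule Lim_transform_eventually)
  show "((\<lambda>e. ereal (exp_quot (of_opmat -` S) (opmat B) e))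
      \<longlongrightarrow> ereal (exp_cond (of_opmat -` S) (opmat B))) (at_right 0)"
    using exp_quot_tendsto[OF subspace_of_opmat_vimage[OF assms(1)]] by simp
  show "eventually (\<lambda>e. ereal (exp_quot (of_opmat -` S) (opmat B) e)
      = cond1_struc_quot S matrix_exp B e) (at_right 0)"
    using cond1_struc_quot_exp[OF assms] by (auto intro: eventually_mono[OF eventually_at_right_less])
qed

lemma cond1_struc_exp:
  fixes B :: "complex^'n^'n"
  assumes "subspace S" "B \<in> S"
  shows "cond1_struc S matrix_exp B = ereal (exp_cond (of_opmat -` S) (opmat B))"
  unfolding cond1_struc_def by (rule tendsto_Lim[OF _ cond1_struc_quot_exp_tendsto[OF assms]]) simp

text \<open>Every \<open>A + Z\<close> considered lies in \<open>S\<close>, so the level-1 numbers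
  are finite and their extended-real differences are real; then \<open>exp_cond_quot_eq\<close>
  applies with the shift from \<open>hermitian_shift\<close>.\<close>

lemma cond2_struc_quot_exp:
  fixes A :: "complex^'n^'n"
  assumes S: "subspace S" "mat 1 \<in> S" and A: "A \<in> S" "A \<in> hermitian_matrices" and e: "e > 0"
  shows "cond2_struc_quot S matrix_exp A e = ereal (exp (lambda_max A) * ((exp e - 1) / e))"
proof -
  let ?T = "of_opmat -` S"
  obtain c where c: "norm (opmat A + of_real c) - c = lambda_max A"
    "norm (exp (opmat A)) = exp (lambda_max A)"
    using hermitian_shift[OF A(2)] .
  have iff: "A + Z \<in> S \<longleftrightarrow> Z \<in> S" for Z
    using S(1) A(1) by (metis add_diff_cancel_left' subspace_add subspace_diff)
  have "cond2_struc_quot S matrix_exp A e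
      = (SUP Z\<in>{Z. Z \<in> S \<and> spectral_norm Z \<le> e}.
          ereal (\<bar>exp_cond ?T (opmat A + opmat Z) - exp_cond ?T (opmat A)\<bar> / e))"
    unfolding cond2_struc_quot_def iff
    using e by (intro SUP_cong) (auto simp: cond1_struc_exp[OF S(1)] A(1) iff opmat_add)
  also have "\<dots> = (SUP z\<in>{z \<in> ?T. norm z \<le> e}.
      ereal (\<bar>exp_cond ?T (opmat A + z) - exp_cond ?T (opmat A)\<bar> / e))"
    by (subst SUP_opmat) (simp add: of_opmat_inverse norm_opmat.rep_eq)
  also have "\<dots> = ereal (exp (norm (opmat A + of_real c) - c) * ((exp e - 1) / e))"
    using S c e by (intro exp_cond_quot_eq subspace_of_opmat_vimage) (auto simp: one_opmat.rep_eq)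
  finally show ?thesis by (simp only: c)
qed

lemma cond2_struc_quot_exp_tendsto:
  fixes A :: "complex^'n^'n"
  assumes "subspace S" "mat 1 \<in> S" "A \<in> S" "A \<in> hermitian_matrices"
  shows "(cond2_struc_quot S matrix_exp A \<longlongrightarrow> ereal (exp (lambda_max A))) (at_right 0)"
proof (rule Lim_transform_eventually)
  show "((\<lambda>e. ereal (exp (lambda_max A) * ((exp e - 1) / e))) \<longlongrightarrow> ereal (exp (lambda_max A))) (at_right 0)"
    using tendsto_mult_left[OF exp_minus_one_over_tendsto, of "exp (lambda_max A)"] by simp
  show "eventually (\<lambda>e. ereal (exp (lambda_max A) * ((exp e - 1) / e))
      = cond2_struc_quot S matrix_exp A e) (at_right 0)"
    using cond2_struc_quot_exp[OF assms] by (auto intro: eventually_mono[OF eventually_at_right_less])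
qed

lemma cond2_struc_exp:
  fixes A :: "complex^'n^'n"
  assumes "subspace S" "mat 1 \<in> S" "A \<in> S" "A \<in> hermitian_matrices"
  shows "cond2_struc S matrix_exp A = ereal (exp (lambda_max A))"
  unfolding cond2_struc_def by (rule tendsto_Lim[OF _ cond2_struc_quot_exp_tendsto[OF assms]]) simp

theorem proposition3p3:
  fixes A :: "complex^'n^'n"
  assumes "A \<in> hermitian_matrices"
  shows "cond2_struc hermitian_matrices matrix_exp A = cond2 matrix_exp A
    \<and> cond2 matrix_exp A = ereal (exp (lambda_max A))
    \<and> (\<forall>B :: complex^'n^'n. \<exists>c::real. (cond1_quot matrix_exp B \<longlongrightarrow> ereal c) (at_right 0))
    \<and> (\<forall>B \<in> hermitian_matrices :: (complex^'n^'n) set.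
         \<exists>c::real. (cond1_struc_quot hermitian_matrices matrix_exp B \<longlongrightarrow> ereal c) (at_right 0))
    \<and> (cond2_quot matrix_exp A \<longlongrightarrow> cond2 matrix_exp A) (at_right 0)
    \<and> (cond2_struc_quot hermitian_matrices matrix_exp A
         \<longlongrightarrow> cond2_struc hermitian_matrices matrix_exp A) (at_right 0)"
proof -
  \<comment> \<open>Two instances of one result, for the Hermitian matrices and for all matrices.
    The value depends only on \<open>A\<close>, so they agree.\<close>
  note H = subspace_hermitian_matrices mat_1_hermitian assms assms
  note U = subspace_UNIV UNIV_I UNIV_I assms
  have cond2: "cond2 matrix_exp A = ereal (exp (lambda_max A))"
    using cond2_struc_exp[OF U] by (simp add: cond2_def cond2_struc_def cond2_quot_eq_struc)
  show ?thesis
    unfolding cond2 cond2_struc_exp[OF H] cond1_quot_eq_struc cond2_quot_eq_struc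
  proof (intro conjI ballI allI)
    show "\<exists>c::real. (cond1_struc_quot UNIV matrix_exp B \<longlongrightarrow> ereal c) (at_right 0)" for B :: "complex^'n^'n"
      using cond1_struc_quot_exp_tendsto[OF subspace_UNIV UNIV_I] by (rule exI)
    show "\<exists>c::real. (cond1_struc_quot hermitian_matrices matrix_exp B \<longlongrightarrow> ereal c) (at_right 0)"
      if "B \<in> hermitian_matrices" for B :: "complex^'n^'n"
      using cond1_struc_quot_exp_tendsto[OF subspace_hermitian_matrices that] by (rule exI)
  qed (rule refl cond2_struc_quot_exp_tendsto[OF H] cond2_struc_quot_exp_tendsto[OF U])+
qed

end
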